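(* For every $h\in(0,2)$, $$\frac{\mathrm d}{\mathrm dh}\bar Q<0,\qquad \bar Q:=2\int_{\Gamma_h}\frac{\big(-\varphi-\ln(1-\varphi)\big)^{1/2}}{1-\varphi}\,\mathrm d\tau ,$$ where $\Gamma_h$ and the parameter $\tau$ along it are as in the context.
   Context: For $h\in(0,2)$, $\Gamma_h$ is the curve $$\Gamma_h:=\Big\{(\varphi,\bar\psi):\ 0<\varphi<1,\ -\bar\psi^2-\frac{\varphi^2}{\varphi+\ln(1-\varphi)}=h\Big\}.$$ It is an arc joining (as limits, $\varphi\to0$) the points $(0,\sqrt{2-h})$ and $(0,-\sqrt{2-h})$, and is traversed from the former to the latter by the solution of $$\frac{\mathrm d\varphi}{\mathrm d\tau}=2\bar\psi,\qquad \frac{\mathrm d\bar\psi}{\mathrm d\tau}=-\frac{\varphi f(\varphi)}{(1-\varphi)(-\varphi-\ln(1-\varphi))^2},\qquad f(\varphi):=\varphi+(1-\varphi)\big(\varphi+2\ln(1-\varphi)\big),$$ and $\int_{\Gamma_h}\cdots\,\mathrm d\tau$ is the integral over the whole arc with respect to this parameter $\tau$; $\bar Q$ is regarded as a function of $h$. *)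

theory Defs
  imports "HOL-Analysis.Analysis"
begin

definition Gamma_curve :: "real \<Rightarrow> (real \<times> real) set" where
  "Gamma_curve h =
     {(\<phi>, \<psi>). 0 < \<phi> \<and> \<phi> < 1 \<and> - \<psi>\<^sup>2 - \<phi>\<^sup>2 / (\<phi> + ln (1 - \<phi>)) = h}"

definition f_aux :: "real \<Rightarrow> real" where
  "f_aux \<phi> = \<phi> + (1 - \<phi>) * (\<phi> + 2 * ln (1 - \<phi>))"

text \<open>
  A solution of the system on a time interval \<open>(a, b)\<close> that runs through the whole arc, from
  \<open>(0, sqrt (2 - h))\<close> to \<open>(0, - sqrt (2 - h))\<close>. The right-hand side is singular at
  \<open>\<phi> = 0\<close>, so the two end points are only attained as limits. The times \<open>a\<close> and \<open>b\<close> are real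
  numbers: the right-hand side has the finite limit \<open>-4/3\<close> in its second component as
  \<open>\<phi> \<rightarrow> 0\<close>, so the end points are reached in finite time.
\<close>
definition traverses ::
    "real \<Rightarrow> real \<Rightarrow> real \<Rightarrow> (real \<Rightarrow> real) \<Rightarrow> (real \<Rightarrow> real) \<Rightarrow> bool" where
  "traverses h a b \<phi> \<psi> \<longleftrightarrow>
     a < b \<and>
     (\<forall>\<tau>\<in>{a<..<b}.
        (\<phi> has_real_derivative 2 * \<psi> \<tau>) (at \<tau>) \<and>
        (\<psi> has_real_derivative
           - (\<phi> \<tau> * f_aux (\<phi> \<tau>) / ((1 - \<phi> \<tau>) * (- \<phi> \<tau> - ln (1 - \<phi> \<tau>))\<^sup>2))) (at \<tau>)) \<and>
     (\<lambda>\<tau>. (\<phi> \<tau>, \<psi> \<tau>)) ` {a<..<b} = Gamma_curve h \<and>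
     (\<phi> \<longlongrightarrow> 0) (at_right a) \<and> (\<psi> \<longlongrightarrow> sqrt (2 - h)) (at_right a) \<and>
     (\<phi> \<longlongrightarrow> 0) (at_left b) \<and> (\<psi> \<longlongrightarrow> - sqrt (2 - h)) (at_left b)"

text \<open>
  The solution is determined only up to a translation of time, which does not change the
  integral; hence the definite description.
\<close>
definition Qbar :: "real \<Rightarrow> real" where
  "Qbar h = (THE q. \<exists>a b \<phi> \<psi>. traverses h a b \<phi> \<psi> \<and>
     q = 2 * integral {a<..<b} (\<lambda>\<tau>. sqrt (- \<phi> \<tau> - ln (1 - \<phi> \<tau>)) / (1 - \<phi> \<tau>)))"

end

theory Submission
  imports Defs "HOL-Real_Asymp.Real_Asymp"
begin

text \<open>
  Write \<open>A \<phi> = - \<phi> - ln (1 - \<phi>)\<close> (below \<open>log_gap\<close>) and \<open>G \<phi> = \<phi>\<^sup>2 / A \<phi>\<close> (below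
  \<open>potential\<close>). The curve is the level set \<open>G \<phi> = h + \<psi>\<^sup>2\<close> of the first integral
  \<open>G \<phi> - \<psi>\<^sup>2\<close>, and the second equation of the system is \<open>d\<psi>/d\<tau> = G' \<phi>\<close>. Since \<open>G\<close>
  decreases from \<open>2\<close> to \<open>0\<close> on \<open>[0, 1)\<close>, the variable \<open>\<psi>\<close> runs monotonically from
  \<open>sqrt (2 - h)\<close> to \<open>- sqrt (2 - h)\<close> and is the good parameter of the arc: there is no turning
  point singularity, and \<open>\<phi> = G\<^sup>-\<^sup>1 (h + \<psi>\<^sup>2)\<close>. With the density
  \<open>\<kappa> \<phi> = sqrt (A \<phi>) / ((1 - \<phi>) * (- G' \<phi>)) = (A \<phi>) powr (5/2) / (\<phi> * f \<phi>)\<close> and the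
  rescaling \<open>\<psi> = sqrt (2 - h) * u\<close>, the integral becomes an integral over a fixed interval,
  \<open>2 * sqrt (2 - h) * (\<integral>u = -1..1. \<kappa> (G\<^sup>-\<^sup>1 (h + (2 - h) * u\<^sup>2)))\<close>.

  The factor \<open>sqrt (2 - h)\<close> decreases in \<open>h\<close>, and \<open>\<kappa> > 0\<close>. As \<open>G\<^sup>-\<^sup>1\<close> is decreasing, the integrand
  decreases in \<open>h\<close> as soon as \<open>\<kappa>\<close> increases in \<open>\<phi>\<close>. Because \<open>f' = 2 * A\<close> and
  \<open>f = \<phi>\<^sup>2 - 2 * (1 - \<phi>) * A\<close>, the sign of \<open>\<kappa>'\<close> is that of
  \<open>f\<^sup>2 / 2 + 2 * \<phi> * (\<phi> * f - (1 - \<phi>) * A\<^sup>2)\<close>; the last bracket vanishes at \<open>0\<close> and has the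
  derivative \<open>f + A\<^sup>2 > 0\<close> (lemma \<open>log_gap_square_less\<close>).

  The rest is regularity. The differentiation under the integral sign needs the
  \<open>h\<close>-derivative of the integrand to be continuous up to \<open>u = \<plusminus>1\<close>, that is up to \<open>\<phi> = 0\<close>
  (lemma \<open>continuous_on_weighted_slope\<close>). That the definite description defining \<open>Qbar\<close> picks
  this integral requires that every traversal has this value (lemma \<open>orbit_integral\<close>) and that
  a traversal exists (lemma \<open>traverses_exists\<close>).
\<close>

section \<open>Elementary estimates on the unit interval\<close>

definition log_gap :: "real \<Rightarrow> real" where
  "log_gap x = - x - ln (1 - x)"

lemma log_gap_0 [simp]: "log_gap 0 = 0"
  by (simp add: log_gap_def)

lemma f_aux_0 [simp]: "f_aux 0 = 0"
  by (simp add: f_aux_def)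

text \<open>
  In this form \<open>f_aux\<close> is easy to differentiate: as \<open>(1 - x) * log_gap' x = x\<close>, everything except
  \<open>2 * log_gap x\<close> cancels.
\<close>
lemma f_aux_eq: "f_aux x = x\<^sup>2 - 2 * (1 - x) * log_gap x"
  by (simp add: f_aux_def log_gap_def algebra_simps power2_eq_square)

lemma log_gap_deriv:
  assumes "x < 1"
  shows "(log_gap has_real_derivative x / (1 - x)) (at x)"
  unfolding log_gap_def [abs_def] using assms
  by (auto intro!: derivative_eq_intros simp: field_simps)

lemma log_gap_pos:
  assumes "0 < x" "x < 1"
  shows "log_gap x > 0"
proof -
  have "ln (1 - x) \<le> (1 - x) - 1" "ln (1 - x) \<noteq> (1 - x) - 1"
    using assms ln_le_minus_one[of "1 - x"] ln_eq_minus_one[of "1 - x"] by auto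
  then show ?thesis by (simp add: log_gap_def)
qed

lemma f_aux_deriv:
  assumes "x < 1"
  shows "(f_aux has_real_derivative 2 * log_gap x) (at x)"
proof -
  define q where "q = x / (1 - x)"
  have q: "(log_gap has_real_derivative q) (at x)" "(1 - x) * q = x"
    using assms log_gap_deriv[of x] by (auto simp: q_def)
  have "((\<lambda>x. x\<^sup>2 - 2 * (1 - x) * log_gap x) has_real_derivative
      2 * x - 2 * ((1 - x) * q) + 2 * log_gap x) (at x)"
    by (auto intro!: derivative_eq_intros q(1) simp: algebra_simps)
  then have "((\<lambda>x. x\<^sup>2 - 2 * (1 - x) * log_gap x) has_real_derivative 2 * log_gap x) (at x)"
    by (simp add: q(2))
  then show ?thesis by (simp add: f_aux_eq [abs_def])
qed

lemma f_aux_pos: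
  assumes "0 < x" "x < 1"
  shows "f_aux x > 0"
proof -
  have "f_aux 0 < f_aux x"
  proof (rule DERIV_pos_imp_increasing_open[of 0 x f_aux])
    show "\<exists>y. (f_aux has_real_derivative y) (at t) \<and> 0 < y" if "0 < t" "t < x" for t
      using that assms f_aux_deriv[of t] log_gap_pos[of t]
      by (intro exI[of _ "2 * log_gap t"]) auto
    show "continuous_on {0..x} f_aux"
      using assms by (auto intro!: DERIV_continuous_on[of _ _ "\<lambda>x. 2 * log_gap x"]
        has_field_derivative_at_within[OF f_aux_deriv])
  qed (use assms in auto)
  then show ?thesis by simp
qed

text \<open>
  The inequality behind the monotonicity of the arc density: the difference of the two sides
  vanishes at \<open>0\<close>, and its derivative collapses to \<open>f_aux x + (log_gap x)\<^sup>2\<close>, because the two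
  contributions \<open>2 * x * log_gap x\<close> cancel.
\<close>
lemma log_gap_square_less:
  assumes "0 < x" "x < 1"
  shows "(1 - x) * (log_gap x)\<^sup>2 < x * f_aux x"
proof -
  let ?P = "\<lambda>x. x * f_aux x - (1 - x) * (log_gap x)\<^sup>2"
  have D: "(?P has_real_derivative f_aux t + (log_gap t)\<^sup>2) (at t)" if "t < 1" for t
  proof -
    define q where "q = t / (1 - t)"
    have q: "(log_gap has_real_derivative q) (at t)" "(1 - t) * q = t"
      using that log_gap_deriv[of t] by (auto simp: q_def)
    have "(?P has_real_derivative
        f_aux t + t * (2 * log_gap t) - 2 * log_gap t * ((1 - t) * q) + (log_gap t)\<^sup>2) (at t)"
      using that
      by (auto intro!: derivative_eq_intros f_aux_deriv q(1) simp: algebra_simps)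
    then show ?thesis by (simp add: q(2))
  qed
  have "?P 0 < ?P x"
  proof (rule DERIV_pos_imp_increasing_open[of 0 x ?P])
    show "\<exists>y. (?P has_real_derivative y) (at t) \<and> 0 < y" if "0 < t" "t < x" for t
      using that assms D[of t] f_aux_pos[of t]
      by (intro exI[of _ "f_aux t + (log_gap t)\<^sup>2"]) (auto intro: add_pos_nonneg)
    show "continuous_on {0..x} ?P"
      using assms
      by (auto intro!: DERIV_continuous_on[of _ _ "\<lambda>t. f_aux t + (log_gap t)\<^sup>2"]
          has_field_derivative_at_within[OF D])
  qed (use assms in auto)
  then show ?thesis by simp
qed

section \<open>The potential and its inverse\<close>

text \<open>
  The value at \<open>0\<close> is the limit, by \<open>log_gap x = x\<^sup>2 / 2 + O(x\<^sup>3)\<close>.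
\<close>
definition potential :: "real \<Rightarrow> real" where
  "potential x = (if x = 0 then 2 else x\<^sup>2 / log_gap x)"

text \<open>
  The reciprocal speed \<open>- d\<tau>/d\<psi>\<close> along the orbit, equal to \<open>- 1 / potential'\<close>; the value at \<open>0\<close>
  is again the limit.
\<close>
definition slowness :: "real \<Rightarrow> real" where
  "slowness x = (if x = 0 then 3 / 4 else (1 - x) * (log_gap x)\<^sup>2 / (x * f_aux x))"

lemma slowness_pos:
  assumes "0 \<le> x" "x < 1"
  shows "slowness x > 0"
  using assms log_gap_pos[of x] f_aux_pos[of x] by (auto simp: slowness_def)

lemma potential_deriv:
  assumes "0 < x" "x < 1"
  shows "(potential has_real_derivative - (1 / slowness x)) (at x)"
proof -
  have pos: "log_gap x > 0" "f_aux x > 0" using assms log_gap_pos f_aux_pos by auto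
  have "((\<lambda>x. x\<^sup>2 / log_gap x) has_real_derivative
          (2 * x * log_gap x - x\<^sup>2 * (x / (1 - x))) / (log_gap x)\<^sup>2) (at x)"
    using assms pos
    by (auto intro!: derivative_eq_intros log_gap_deriv simp: power2_eq_square)
  moreover have "(2 * x * log_gap x - x\<^sup>2 * (x / (1 - x))) / (log_gap x)\<^sup>2 =
      - (1 / slowness x)"
    using assms pos by (simp add: slowness_def f_aux_eq field_simps power2_eq_square)
  ultimately have "((\<lambda>x. x\<^sup>2 / log_gap x) has_real_derivative - (1 / slowness x)) (at x)"
    by simp
  then show ?thesis
    by (rule has_field_derivative_transform_within_open[of _ _ _ "{0<..}"])
       (use assms in \<open>auto simp: potential_def\<close>)
qed

lemma continuous_on_zero_extension:
  fixes f :: "real \<Rightarrow> real"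
  assumes "continuous_on {0<..<1} f" "(f \<longlongrightarrow> f 0) (at_right 0)"
  shows "continuous_on {0..<1} f"
  unfolding continuous_on_def
proof
  fix x :: real assume x: "x \<in> {0..<1}"
  show "(f \<longlongrightarrow> f x) (at x within {0..<1})"
  proof (cases "x = 0")
    case True
    have "(f \<longlongrightarrow> f 0) (at 0 within {0..1})"
      using assms(2) by (simp add: at_within_Icc_at_right)
    then show ?thesis unfolding True by (rule tendsto_within_subset) auto
  next
    case False
    then have "(f \<longlongrightarrow> f x) (at x)"
      using x assms(1) by (simp add: continuous_on_eq_continuous_at isCont_def)
    then show ?thesis by (rule tendsto_within_subset) auto
  qed
qed

lemma continuous_on_log_gap: "continuous_on {..<1} log_gap"
  by (rule DERIV_continuous_on[of _ _ "\<lambda>x. x / (1 - x)"])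
     (auto intro!: has_field_derivative_at_within[OF log_gap_deriv])

lemma continuous_on_f_aux: "continuous_on {..<1} f_aux"
  by (rule DERIV_continuous_on[of _ _ "\<lambda>x. 2 * log_gap x"])
     (auto intro!: has_field_derivative_at_within[OF f_aux_deriv])

lemmas continuous_on_unit_interval [continuous_intros] =
  continuous_on_subset[OF continuous_on_log_gap] continuous_on_subset[OF continuous_on_f_aux]

lemma potential_tendsto_0: "(potential \<longlongrightarrow> potential 0) (at_right 0)"
proof (rule Lim_transform_eventually)
  show "((\<lambda>x. x\<^sup>2 / log_gap x) \<longlongrightarrow> potential 0) (at_right 0)"
    unfolding potential_def log_gap_def by real_asymp
  show "\<forall>\<^sub>F x in at_right 0. x\<^sup>2 / log_gap x = potential x"
    by (rule eventually_at_rightI[of 0 1]) (auto simp: potential_def)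
qed

lemma continuous_on_potential: "continuous_on {0..<1} potential"
proof (rule continuous_on_zero_extension)
  show "continuous_on {0<..<1} potential"
    by (rule DERIV_continuous_on[of _ _ "\<lambda>x. - (1 / slowness x)"])
       (auto intro!: has_field_derivative_at_within[OF potential_deriv])
qed (rule potential_tendsto_0)

lemma slowness_tendsto_0: "(slowness \<longlongrightarrow> slowness 0) (at_right 0)"
proof (rule Lim_transform_eventually)
  have "((\<lambda>x. (1 - x) * (log_gap x)\<^sup>2 / (x * f_aux x)) \<longlongrightarrow> 3 / 4) (at_right 0)"
    unfolding log_gap_def f_aux_def by (real_asymp simp: power2_eq_square)
  then show "((\<lambda>x. (1 - x) * (log_gap x)\<^sup>2 / (x * f_aux x)) \<longlongrightarrow> slowness 0) (at_right 0)"
    by (simp add: slowness_def)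
  show "\<forall>\<^sub>F x in at_right 0. (1 - x) * (log_gap x)\<^sup>2 / (x * f_aux x) = slowness x"
    by (rule eventually_at_rightI[of 0 1]) (auto simp: slowness_def)
qed

lemma continuous_on_slowness: "continuous_on {0..<1} slowness"
proof (rule continuous_on_zero_extension)
  have "continuous_on {0<..<1} (\<lambda>x. (1 - x) * (log_gap x)\<^sup>2 / (x * f_aux x))"
    using f_aux_pos by (fastforce intro!: continuous_intros)
  then show "continuous_on {0<..<1} slowness"
    by (rule continuous_on_eq) (auto simp: slowness_def)
qed (rule slowness_tendsto_0)

lemma potential_strict_antimono:
  assumes "0 \<le> x" "x < y" "y < 1"
  shows "potential y < potential x"
proof (rule DERIV_neg_imp_decreasing_open[of x y potential])
  show "\<exists>d. (potential has_real_derivative d) (at t) \<and> d < 0" if "x < t" "t < y" for t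
    using that assms potential_deriv[of t] slowness_pos[of t]
    by (intro exI[of _ "- (1 / slowness t)"]) auto
  show "continuous_on {x..y} potential"
    using assms by (intro continuous_on_subset[OF continuous_on_potential]) auto
qed (use assms in auto)

lemma potential_less_iff:
  assumes "x \<in> {0..<1}" "y \<in> {0..<1}"
  shows "potential x < potential y \<longleftrightarrow> y < x"
  using assms potential_strict_antimono[of x y] potential_strict_antimono[of y x]
  by (cases x y rule: linorder_cases) auto

text \<open>
  Intermediate values: the potential starts at \<open>2\<close>, and it tends to \<open>0\<close> at \<open>1\<close> because the
  logarithm diverges there.
\<close>
lemma potential_surj:
  assumes "w \<in> {0<..2}"
  obtains x where "x \<in> {0..<1}" "potential x = w"
proof -
  have "((\<lambda>x. x\<^sup>2 / log_gap x) \<longlongrightarrow> 0) (at_left 1)"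
    unfolding log_gap_def by real_asymp
  then have "\<forall>\<^sub>F x in at_left 1. x\<^sup>2 / log_gap x < w"
    using assms by (intro order_tendstoD(2)) auto
  moreover have "\<forall>\<^sub>F x in at_left 1. x \<in> {0<..<1::real}"
    by (rule eventually_at_left_real) auto
  ultimately have "\<forall>\<^sub>F x in at_left 1. x\<^sup>2 / log_gap x < w \<and> x \<in> {0<..<1}"
    by (rule eventually_conj)
  then obtain y where y: "y\<^sup>2 / log_gap y < w" "y \<in> {0<..<1}"
    using eventually_happens'[of "at_left (1::real)"] by auto
  have "\<exists>x. 0 \<le> x \<and> x \<le> y \<and> potential x = w"
    using y assms
    by (intro IVT2' continuous_on_subset[OF continuous_on_potential])
       (auto simp: potential_def)
  then obtain x where "0 \<le> x" "x \<le> y" "potential x = w" by blast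
  then show ?thesis using y by (intro that[of x]) auto
qed

definition potential_inv :: "real \<Rightarrow> real" where
  "potential_inv = the_inv_into {0..<1} potential"

lemma inj_on_potential: "inj_on potential {0..<1}"
  using potential_less_iff by (metis inj_onI less_irrefl linorder_neqE)

lemma potential_inv_potential [simp]:
  "x \<in> {0..<1} \<Longrightarrow> potential_inv (potential x) = x"
  unfolding potential_inv_def by (rule the_inv_into_f_f[OF inj_on_potential])

lemma
  assumes "w \<in> {0<..2}"
  shows potential_inv_in: "potential_inv w \<in> {0..<1}"
    and potential_potential_inv: "potential (potential_inv w) = w"
  using potential_surj[OF assms] potential_inv_potential by metis+

lemma potential_inv_2 [simp]: "potential_inv 2 = 0"
  using potential_inv_potential[of 0] by (simp add: potential_def)

lemma potential_inv_in_open: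
  assumes "w \<in> {0<..<2}"
  shows "potential_inv w \<in> {0<..<1}"
  using potential_inv_in[of w] potential_potential_inv[of w] assms
  by (cases "potential_inv w = 0") (auto simp: potential_def)

text \<open>
  The domain \<open>[0, 1)\<close> of the potential is not compact, so the continuity of the inverse near a
  level \<open>w\<close> is obtained from the compact piece on which the potential is at least \<open>w / 2\<close>. The
  level \<open>2\<close>, which corresponds to the end points of the arc, is included.
\<close>
lemma continuous_on_potential_inv: "continuous_on {0<..2} potential_inv"
  unfolding continuous_on_eq_continuous_within
proof
  fix w :: real assume w: "w \<in> {0<..2}"
  define c where "c = potential_inv (w / 2)"
  have c: "c \<in> {0..<1}" "potential c = w / 2"
    using w potential_inv_in[of "w / 2"] potential_potential_inv[of "w / 2"]
    by (auto simp: c_def)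
  have "continuous_on (potential ` {0..c}) potential_inv"
    using c by (intro continuous_on_inv continuous_on_subset[OF continuous_on_potential]) auto
  moreover have "{w / 2..2} \<subseteq> potential ` {0..c}"
  proof
    fix v assume v: "v \<in> {w / 2..2}"
    then have v': "potential_inv v \<in> {0..<1}" "potential (potential_inv v) = v"
      using w potential_inv_in[of v] potential_potential_inv[of v] by auto
    moreover have "potential_inv v \<le> c"
      using potential_less_iff[OF v'(1) c(1)] v' c v by auto
    ultimately show "v \<in> potential ` {0..c}" by force
  qed
  ultimately have "continuous_on {w / 2..2} potential_inv"
    by (rule continuous_on_subset)
  then have "continuous (at w within {w / 2..2}) potential_inv"
    using w by (simp add: continuous_on_eq_continuous_within)
  moreover have "at w within {w / 2..2} = at w within {0<..2}"
    using w by (intro at_within_nhd[of w "{w / 2<..}"]) auto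
  ultimately show "continuous (at w within {0<..2}) potential_inv" by simp
qed

lemma potential_inv_deriv:
  assumes "w \<in> {0<..<2}"
  shows "(potential_inv has_real_derivative - slowness (potential_inv w)) (at w)"
proof -
  have g: "potential_inv w \<in> {0<..<1}" using assms by (rule potential_inv_in_open)
  have "(potential_inv has_real_derivative inverse (- (1 / slowness (potential_inv w)))) (at w)"
  proof (rule DERIV_inverse_function)
    show "(potential has_real_derivative - (1 / slowness (potential_inv w)))
            (at (potential_inv w))"
      using g by (intro potential_deriv) auto
    show "- (1 / slowness (potential_inv w)) \<noteq> 0"
      using g slowness_pos[of "potential_inv w"] by auto
    show "0 < w" "w < 2" using assms by auto
    show "potential (potential_inv y) = y" if "0 < y" "y < 2" for y
      using that by (intro potential_potential_inv) auto
    have "continuous_on {0<..<2} potential_inv"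
      by (rule continuous_on_subset[OF continuous_on_potential_inv]) auto
    then show "isCont potential_inv w"
      using assms by (simp add: continuous_on_eq_continuous_at)
  qed
  then show ?thesis by (simp add: inverse_eq_divide)
qed

section \<open>The density of the integral with respect to \<open>\<psi>\<close>\<close>

text \<open>
  The integrand of \<open>Qbar\<close> times \<open>- d\<tau>/d\<psi>\<close>, so that it is integrated against \<open>- d\<psi>\<close>.
\<close>
definition arc_density :: "real \<Rightarrow> real" where
  "arc_density x = sqrt (log_gap x) / (1 - x) * slowness x"

text \<open>
  The derivative of the arc density, factored through its logarithmic derivative. At \<open>x = 0\<close> the
  factor \<open>arc_density 0 = 0\<close> makes it \<open>0\<close>.
\<close>
definition arc_density_deriv :: "real \<Rightarrow> real" where
  "arc_density_deriv x =
     arc_density x * (5 / 2 * x / ((1 - x) * log_gap x) - 1 / x - 2 * log_gap x / f_aux x)"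

lemma arc_density_0 [simp]: "arc_density 0 = 0"
  by (simp add: arc_density_def)

lemma arc_density_pos:
  assumes "0 < x" "x < 1"
  shows "arc_density x > 0"
  using assms log_gap_pos[of x] slowness_pos[of x] by (auto simp: arc_density_def)

lemma arc_density_eq:
  assumes "0 < x" "x < 1"
  shows "arc_density x = sqrt (log_gap x) * (log_gap x)\<^sup>2 / (x * f_aux x)"
  using assms by (simp add: arc_density_def slowness_def)

lemma arc_density_tendsto_0: "(arc_density \<longlongrightarrow> arc_density 0) (at_right 0)"
proof -
  have "((\<lambda>x. sqrt (log_gap x) / (1 - x)) \<longlongrightarrow> 0) (at_right 0)"
    unfolding log_gap_def by real_asymp
  from tendsto_mult[OF this slowness_tendsto_0] show ?thesis
    by (simp add: arc_density_def [abs_def])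
qed

lemma continuous_on_density: "continuous_on {0..<1} arc_density"
  unfolding arc_density_def by (intro continuous_intros continuous_on_slowness) auto

lemma arc_density_has_deriv:
  assumes "0 < x" "x < 1"
  shows "(arc_density has_real_derivative arc_density_deriv x) (at x)"
proof -
  define q r n d where "q = x / (1 - x)" and "r = sqrt (log_gap x)"
    and "n = r * (log_gap x)\<^sup>2" and "d = x * f_aux x"
  have pos: "log_gap x > 0" "f_aux x > 0" using assms log_gap_pos f_aux_pos by auto
  then have r: "r > 0" "log_gap x = r\<^sup>2" and d: "d \<noteq> 0"
    using assms by (auto simp: r_def d_def)
  have A: "(log_gap has_real_derivative q) (at x)"
    using assms log_gap_deriv[of x] by (simp add: q_def)
  have "((\<lambda>x. sqrt (log_gap x)) has_real_derivative inverse r / 2 * q) (at x)"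
    unfolding r_def by (rule DERIV_chain2[OF DERIV_real_sqrt[OF pos(1)] A])
  moreover have "((\<lambda>x. (log_gap x)\<^sup>2) has_real_derivative 2 * log_gap x * q) (at x)"
    by (auto intro!: derivative_eq_intros A)
  ultimately have "((\<lambda>x. sqrt (log_gap x) * (log_gap x)\<^sup>2) has_real_derivative
      inverse r / 2 * q * (log_gap x)\<^sup>2 + 2 * log_gap x * q * sqrt (log_gap x)) (at x)"
    by (rule DERIV_mult)
  moreover have "inverse r / 2 * q * (log_gap x)\<^sup>2 + 2 * log_gap x * q * sqrt (log_gap x)
      = n * (5 / 2 * q / log_gap x)"
    using r(1) unfolding n_def r_def[symmetric] r(2) by (simp add: field_simps power2_eq_square)
  ultimately have N: "((\<lambda>x. sqrt (log_gap x) * (log_gap x)\<^sup>2) has_real_derivative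
      n * (5 / 2 * q / log_gap x)) (at x)" by simp
  have "((\<lambda>x. x * f_aux x) has_real_derivative 1 * f_aux x + 2 * log_gap x * x) (at x)"
    by (rule DERIV_mult[OF DERIV_ident f_aux_deriv[OF assms(2)]])
  moreover have "1 * f_aux x + 2 * log_gap x * x = d * (1 / x + 2 * log_gap x / f_aux x)"
    using assms pos by (simp add: d_def field_simps)
  ultimately have D: "((\<lambda>x. x * f_aux x) has_real_derivative
      d * (1 / x + 2 * log_gap x / f_aux x)) (at x)" by simp
  \<comment> \<open>The quotient rule when the derivatives of numerator and denominator are given logarithmically.\<close>
  have quotient: "(n * a * d - n * (d * b)) / (d * d) = n / d * (a - b)" for a b
    using d by (simp add: field_simps)
  have "n / d = arc_density x"
    using assms by (simp add: n_def d_def r_def arc_density_eq)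
  moreover have "5 / 2 * q / log_gap x = 5 / 2 * x / ((1 - x) * log_gap x)"
    by (simp add: q_def)
  ultimately have eq: "n / d * (5 / 2 * q / log_gap x - (1 / x + 2 * log_gap x / f_aux x))
      = arc_density_deriv x"
    by (simp add: arc_density_deriv_def)
  have "((\<lambda>x. sqrt (log_gap x) * (log_gap x)\<^sup>2 / (x * f_aux x)) has_real_derivative
      (n * (5 / 2 * q / log_gap x) * d - n * (d * (1 / x + 2 * log_gap x / f_aux x))) / (d * d))
      (at x)"
    using DERIV_divide[OF N D] d by (simp add: n_def d_def r_def)
  then have "((\<lambda>x. sqrt (log_gap x) * (log_gap x)\<^sup>2 / (x * f_aux x))
      has_real_derivative arc_density_deriv x) (at x)"
    unfolding quotient eq .
  then show ?thesis
    by (rule has_field_derivative_transform_within_open[of _ _ _ "{0<..<1}"])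
       (use assms arc_density_eq in auto)
qed

text \<open>
  Over the common denominator, and with \<open>(1 - x) * log_gap x = (x\<^sup>2 - f_aux x) / 2\<close> inserted in the
  middle term, the numerator of the logarithmic derivative is a positive combination of a square
  and the difference in \<open>log_gap_square_less\<close>.
\<close>
lemma arc_density_deriv_pos:
  assumes "0 < x" "x < 1"
  shows "arc_density_deriv x > 0"
proof -
  have pos: "log_gap x > 0" "f_aux x > 0" using assms log_gap_pos f_aux_pos by auto
  let ?A = "log_gap x" and ?f = "f_aux x"
  have "5 / 2 * x / ((1 - x) * ?A) - 1 / x - 2 * ?A / ?f
      = (5 / 2 * x\<^sup>2 * ?f - (1 - x) * ?A * ?f - 2 * (1 - x) * x * ?A\<^sup>2) / ((1 - x) * ?A * x * ?f)"
    using assms pos by (simp add: field_simps power2_eq_square)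
  moreover have "5 / 2 * x\<^sup>2 * ?f - (1 - x) * ?A * ?f - 2 * (1 - x) * x * ?A\<^sup>2
      = ?f\<^sup>2 / 2 + 2 * x * (x * ?f - (1 - x) * ?A\<^sup>2)"
    by (simp add: f_aux_eq field_simps power2_eq_square)
  moreover have "\<dots> > 0"
    using assms pos log_gap_square_less[OF assms] by (intro add_pos_pos mult_pos_pos) auto
  ultimately show ?thesis
    using assms pos arc_density_pos[OF assms] by (simp add: arc_density_deriv_def)
qed

text \<open>
  If \<open>x\<close> lies on the level \<open>w = potential x\<close>, then \<open>- arc_density_deriv x * slowness x\<close> is the
  derivative of the density with respect to \<open>w\<close>. For \<open>w = h + (2 - h) * u\<^sup>2\<close> the chain rule
  contributes \<open>dw/dh = 1 - u\<^sup>2 = (2 - w) / (2 - h)\<close>; the factor \<open>2 - potential x\<close> absorbs this and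
  makes the expression vanish at the end point \<open>x = 0\<close>.
\<close>
definition weighted_slope :: "real \<Rightarrow> real" where
  "weighted_slope x = arc_density_deriv x * slowness x * (2 - potential x)"

lemma weighted_slope_0 [simp]: "weighted_slope 0 = 0"
  by (simp add: weighted_slope_def arc_density_deriv_def)

lemma weighted_slope_nonneg:
  assumes "x \<in> {0..<1}"
  shows "weighted_slope x \<ge> 0"
  using assms arc_density_deriv_pos[of x] slowness_pos[of x] potential_strict_antimono[of 0 x]
  by (cases "x = 0") (auto simp: weighted_slope_def potential_def)

text \<open>
  Near \<open>0\<close> the logarithmic derivative of the density behaves like \<open>1 / x\<close>, whereas
  \<open>2 - potential x\<close> behaves like \<open>4 / 3 * x\<close>. Their product is bounded, and the density itself
  tends to \<open>0\<close>.
\<close>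
lemma continuous_on_weighted_slope: "continuous_on {0..<1} weighted_slope"
proof (rule continuous_on_zero_extension)
  have *: "log_gap x \<noteq> 0" "f_aux x \<noteq> 0" if "x \<in> {0<..<1}" for x
    using that log_gap_pos[of x] f_aux_pos[of x] by auto
  have sub: "{0<..<1} \<subseteq> {0..<1::real}" by auto
  show "continuous_on {0<..<1} weighted_slope"
    unfolding weighted_slope_def arc_density_deriv_def
    by (intro continuous_intros continuous_on_subset[OF continuous_on_slowness sub]
          continuous_on_subset[OF continuous_on_potential sub]
          continuous_on_subset[OF continuous_on_density sub]) (use * in auto)
next
  have 1: "((\<lambda>x. x * (5 / 2 * x / ((1 - x) * log_gap x) - 1 / x - 2 * log_gap x / f_aux x))
      \<longlongrightarrow> 1) (at_right 0)"
    unfolding log_gap_def f_aux_def by real_asymp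
  have 2: "((\<lambda>x. (2 - x\<^sup>2 / log_gap x) / x) \<longlongrightarrow> 4 / 3) (at_right 0)"
    unfolding log_gap_def by real_asymp
  have "((\<lambda>x. arc_density x * (x * (5 / 2 * x / ((1 - x) * log_gap x) - 1 / x
            - 2 * log_gap x / f_aux x)) * slowness x * ((2 - x\<^sup>2 / log_gap x) / x))
      \<longlongrightarrow> arc_density 0 * 1 * slowness 0 * (4 / 3)) (at_right 0)"
    by (intro tendsto_mult arc_density_tendsto_0 slowness_tendsto_0 1 2)
  then have "((\<lambda>x. arc_density x * (x * (5 / 2 * x / ((1 - x) * log_gap x) - 1 / x
            - 2 * log_gap x / f_aux x)) * slowness x * ((2 - x\<^sup>2 / log_gap x) / x))
      \<longlongrightarrow> weighted_slope 0) (at_right 0)" by simp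
  moreover have "\<forall>\<^sub>F x in at_right 0. arc_density x * (x * (5 / 2 * x / ((1 - x) * log_gap x) - 1 / x
            - 2 * log_gap x / f_aux x)) * slowness x * ((2 - x\<^sup>2 / log_gap x) / x)
        = weighted_slope x"
    by (rule eventually_at_rightI[of 0 1])
       (auto simp: weighted_slope_def arc_density_deriv_def potential_def)
  ultimately show "(weighted_slope \<longlongrightarrow> weighted_slope 0) (at_right 0)"
    by (rule Lim_transform_eventually)
qed

section \<open>Reduction of the orbit integral\<close>

text \<open>
  The coordinate \<open>\<phi>\<close> of the point of the curve of level \<open>h\<close> with \<open>\<psi> = sqrt (2 - h) * u\<close>.
\<close>
definition profile :: "real \<Rightarrow> real \<Rightarrow> real" where
  "profile h u = potential_inv (h + (2 - h) * u\<^sup>2)"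

lemma level_in:
  fixes h u :: real
  assumes "h \<in> {0<..<2}" "u \<in> {-1..1}"
  shows "h + (2 - h) * u\<^sup>2 \<in> {0<..2}"
proof -
  have h: "0 < h" "h < 2" using assms by auto
  have "u\<^sup>2 \<le> 1" using assms by (simp add: abs_square_le_1 abs_le_iff)
  then have "(2 - h) * u\<^sup>2 \<le> 2 - h" using h mult_left_mono[of "u\<^sup>2" 1 "2 - h"] by simp
  then have "h + (2 - h) * u\<^sup>2 \<le> 2" by linarith
  moreover have "0 < h + (2 - h) * u\<^sup>2" using h by (intro add_pos_nonneg) auto
  ultimately show ?thesis unfolding greaterThanAtMost_iff by blast
qed

lemma level_in_open:
  fixes h u :: real
  assumes "h \<in> {0<..<2}" "u \<in> {-1<..<1}"
  shows "h + (2 - h) * u\<^sup>2 \<in> {0<..<2}"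
proof -
  have "u\<^sup>2 < 1" using assms by (simp add: abs_square_less_1 abs_less_iff)
  then have "(2 - h) * u\<^sup>2 < (2 - h) * 1" using assms by (intro mult_strict_left_mono) auto
  moreover have "(2 - h) * u\<^sup>2 \<ge> 0" using assms by simp
  ultimately show ?thesis using assms by auto
qed

lemma profile_in:
  assumes "h \<in> {0<..<2}" "u \<in> {-1..1}"
  shows "profile h u \<in> {0..<1}"
  unfolding profile_def by (rule potential_inv_in[OF level_in[OF assms]])

lemma continuous_on_profile:
  "continuous_on ({0<..<2} \<times> {-1..1}) (\<lambda>(h, u). profile h u)"
  unfolding profile_def case_prod_unfold
  by (rule continuous_on_compose2[OF continuous_on_potential_inv])
     (use level_in in \<open>auto intro!: continuous_intros\<close>)

lemma continuous_on_comp_profile: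
  assumes "continuous_on {0..<1} F" "h \<in> {0<..<2}"
  shows "continuous_on {-1..1} (\<lambda>u. F (profile h u))"
proof (rule continuous_on_compose2[OF assms(1)])
  have "continuous_on {-1..1} (\<lambda>u. (\<lambda>(h, u). profile h u) (h, u))"
    using assms by (intro continuous_on_compose2[OF continuous_on_profile] continuous_intros) auto
  then show "continuous_on {-1..1} (profile h)" by simp
qed (use profile_in assms in auto)

lemma Gamma_curve_iff:
  assumes "h \<in> {0<..<2}"
  shows "(p, q) \<in> Gamma_curve h \<longleftrightarrow>
      q / sqrt (2 - h) \<in> {-1<..<1} \<and> p = profile h (q / sqrt (2 - h))"
proof -
  define s where "s = sqrt (2 - h)"
  have s: "s > 0" "s\<^sup>2 = 2 - h" using assms by (auto simp: s_def)
  have w: "h + (2 - h) * (q / s)\<^sup>2 = h + q\<^sup>2"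
    using s by (simp add: power_divide flip: s(2))
  show ?thesis unfolding s_def[symmetric]
  proof
    assume "(p, q) \<in> Gamma_curve h"
    then have p: "p \<in> {0<..<1}" and e: "- q\<^sup>2 - p\<^sup>2 / (p + ln (1 - p)) = h"
      by (auto simp: Gamma_curve_def)
    have "p + ln (1 - p) = - log_gap p" by (simp add: log_gap_def)
    with e have pe: "potential p = h + q\<^sup>2" using p by (simp add: potential_def)
    moreover have "potential p < potential 0" using p by (intro potential_strict_antimono) auto
    ultimately have "q\<^sup>2 < s\<^sup>2" using s by (simp add: potential_def)
    then have "\<bar>q\<bar> < s" using power2_less_imp_less[of "\<bar>q\<bar>" s] s by simp
    moreover have "profile h (q / s) = p"
      using p unfolding profile_def w by (simp flip: pe)
    ultimately show "q / s \<in> {-1<..<1} \<and> p = profile h (q / s)"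
      using s by (auto simp: field_simps abs_less_iff)
  next
    assume "q / s \<in> {-1<..<1} \<and> p = profile h (q / s)"
    then have u: "q / s \<in> {-1<..<1}" and p: "p = potential_inv (h + q\<^sup>2)"
      by (auto simp: profile_def w)
    have in2: "h + q\<^sup>2 \<in> {0<..<2}" using level_in_open[OF assms u] w by simp
    have "p \<in> {0<..<1}" "potential p = h + q\<^sup>2"
      using potential_inv_in_open[OF in2] potential_potential_inv[of "h + q\<^sup>2"] in2
      by (auto simp: p)
    moreover have "p + ln (1 - p) = - log_gap p" by (simp add: log_gap_def)
    ultimately show "(p, q) \<in> Gamma_curve h"
      by (auto simp: Gamma_curve_def potential_def)
  qed
qed

lemma field_rhs_eq:
  assumes "x \<in> {0<..<1}"
  shows "- (x * f_aux x / ((1 - x) * (- x - ln (1 - x))\<^sup>2)) = - (1 / slowness x)"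
  using assms by (simp add: slowness_def log_gap_def)

lemma integral_deriv_at:
  fixes k :: "real \<Rightarrow> real"
  assumes "continuous_on {a..b} k" "u \<in> {a<..<b}"
  shows "((\<lambda>x. integral {a..x} k) has_real_derivative k u) (at u)"
  using integral_has_real_derivative[OF assms(1), of u] assms(2)
  by (simp add: at_within_Icc_at)

text \<open>
  The change of variables is done on primitives: if \<open>J\<close> is a primitive of the density along the profile, then
  \<open>- sqrt (2 - h) * J (\<psi> \<tau> / sqrt (2 - h))\<close> is a primitive of the integrand in \<open>\<tau>\<close>, and the
  prescribed limits of \<open>\<psi>\<close> at the two ends of the time interval give its increment.
\<close>
lemma orbit_integral:
  assumes h: "h \<in> {0<..<2}" and tr: "traverses h a b \<phi> \<psi>"
  shows "integral {a<..<b} (\<lambda>\<tau>. sqrt (- \<phi> \<tau> - ln (1 - \<phi> \<tau>)) / (1 - \<phi> \<tau>))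
    = sqrt (2 - h) * integral {-1..1} (\<lambda>u. arc_density (profile h u))"
proof -
  define s where "s = sqrt (2 - h)"
  have s: "s > 0" using h by (auto simp: s_def)
  define k where "k = (\<lambda>u. arc_density (profile h u))"
  have k: "continuous_on {-1..1} k"
    unfolding k_def by (rule continuous_on_comp_profile[OF continuous_on_density h])
  define J where "J = (\<lambda>u. integral {-1..u} k)"
  have J: "continuous_on {-1..1} J"
    unfolding J_def
    by (intro indefinite_integral_continuous_1 integrable_continuous_real k)
  have ab: "a < b" using tr by (simp add: traverses_def)
  have curve: "\<psi> \<tau> / s \<in> {-1<..<1}" "\<phi> \<tau> = profile h (\<psi> \<tau> / s)" "\<phi> \<tau> \<in> {0<..<1}"
    if "\<tau> \<in> {a<..<b}" for \<tau>
  proof -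
    have "(\<phi> \<tau>, \<psi> \<tau>) \<in> Gamma_curve h" using tr that unfolding traverses_def by blast
    then show "\<psi> \<tau> / s \<in> {-1<..<1}" "\<phi> \<tau> = profile h (\<psi> \<tau> / s)" "\<phi> \<tau> \<in> {0<..<1}"
      using Gamma_curve_iff[OF h] by (auto simp: s_def Gamma_curve_def)
  qed
  have psi': "(\<psi> has_real_derivative - (1 / slowness (\<phi> \<tau>))) (at \<tau>)"
    if "\<tau> \<in> {a<..<b}" for \<tau>
    using tr that unfolding traverses_def field_rhs_eq[OF curve(3)[OF that], symmetric] by blast
  \<comment> \<open>The rescaled \<open>\<psi>\<close>, extended continuously to the closed time interval by its limits.\<close>
  define v where "v \<tau> = (if \<tau> \<le> a then 1 else if \<tau> \<ge> b then -1 else \<psi> \<tau> / s)" for \<tau>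
  have v_eq: "v \<tau> = \<psi> \<tau> / s" if "\<tau> \<in> {a<..<b}" for \<tau> using that by (simp add: v_def)
  have v_in: "v \<tau> \<in> {-1..1}" for \<tau>
    using curve(1)[of \<tau>] by (auto simp: v_def)
  have v_deriv: "(v has_real_derivative - (1 / slowness (\<phi> \<tau>)) / s) (at \<tau>)"
    if "\<tau> \<in> {a<..<b}" for \<tau>
  proof (rule has_field_derivative_transform_within_open[of _ _ _ "{a<..<b}"])
    show "((\<lambda>\<tau>. \<psi> \<tau> / s) has_real_derivative - (1 / slowness (\<phi> \<tau>)) / s) (at \<tau>)"
      by (rule DERIV_cdivide[OF psi'[OF that]])
  qed (use that v_eq in auto)
  have "continuous_on {a..b} v"
  proof (rule continuous_on_IccI)
    have "(\<psi> \<longlongrightarrow> s) (at_right a)" "(\<psi> \<longlongrightarrow> - s) (at_left b)"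
      using tr by (auto simp: traverses_def s_def)
    then have "((\<lambda>\<tau>. \<psi> \<tau> / s) \<longlongrightarrow> s / s) (at_right a)" "((\<lambda>\<tau>. \<psi> \<tau> / s) \<longlongrightarrow> - s / s) (at_left b)"
      using s by (intro tendsto_intros; simp)+
    then have "((\<lambda>\<tau>. \<psi> \<tau> / s) \<longlongrightarrow> v a) (at_right a)" "((\<lambda>\<tau>. \<psi> \<tau> / s) \<longlongrightarrow> v b) (at_left b)"
      using s ab by (auto simp: v_def)
    moreover have "\<forall>\<^sub>F \<tau> in at_right a. \<psi> \<tau> / s = v \<tau>"
      using ab v_eq by (intro eventually_at_rightI[of a b]) auto
    moreover have "\<forall>\<^sub>F \<tau> in at_left b. \<psi> \<tau> / s = v \<tau>"
      using ab v_eq by (intro eventually_at_leftI[of a b]) auto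
    ultimately show "(v \<longlongrightarrow> v a) (at_right a)" "(v \<longlongrightarrow> v b) (at_left b)"
      by (auto intro: Lim_transform_eventually)
    show "v \<midarrow>\<tau>\<rightarrow> v \<tau>" if "a < \<tau>" "\<tau> < b" for \<tau>
      using DERIV_isCont[OF v_deriv] that by (simp add: isCont_def)
  qed (fact ab)
  then have cont: "continuous_on {a..b} (\<lambda>\<tau>. - (s * J (v \<tau>)))"
    using v_in by (intro continuous_intros continuous_on_compose2[OF J]) auto
  have deriv: "((\<lambda>\<tau>. - (s * J (v \<tau>))) has_vector_derivative
      sqrt (- \<phi> \<tau> - ln (1 - \<phi> \<tau>)) / (1 - \<phi> \<tau>)) (at \<tau>)" if "\<tau> \<in> {a<..<b}" for \<tau>
  proof -
    have "(J has_real_derivative k (v \<tau>)) (at (v \<tau>))"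
      unfolding J_def using curve(1)[OF that] v_eq[OF that] by (intro integral_deriv_at[OF k]) simp
    from DERIV_chain2[OF this v_deriv[OF that]]
    have "((\<lambda>\<tau>. - (s * J (v \<tau>))) has_real_derivative
        - (s * (k (v \<tau>) * (- (1 / slowness (\<phi> \<tau>)) / s)))) (at \<tau>)"
      by (intro DERIV_minus DERIV_cmult)
    moreover have "- (s * (k (v \<tau>) * (- (1 / slowness (\<phi> \<tau>)) / s))) =
        sqrt (- \<phi> \<tau> - ln (1 - \<phi> \<tau>)) / (1 - \<phi> \<tau>)"
      using s curve(3)[OF that] slowness_pos[of "\<phi> \<tau>"]
      by (simp add: k_def v_eq[OF that] curve(2)[OF that, symmetric] arc_density_def log_gap_def)
    ultimately show ?thesis by (simp add: has_real_derivative_iff_has_vector_derivative)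
  qed
  have "((\<lambda>\<tau>. sqrt (- \<phi> \<tau> - ln (1 - \<phi> \<tau>)) / (1 - \<phi> \<tau>)) has_integral
      - (s * J (v b)) - - (s * J (v a))) {a..b}"
    using ab by (intro fundamental_theorem_of_calculus_interior cont deriv) auto
  then have "integral {a<..<b} (\<lambda>\<tau>. sqrt (- \<phi> \<tau> - ln (1 - \<phi> \<tau>)) / (1 - \<phi> \<tau>))
      = - (s * J (v b)) - - (s * J (v a))"
    by (simp add: has_integral_Icc_iff_Ioo integral_unique)
  also have "\<dots> = s * J 1" using ab by (simp add: v_def J_def)
  finally show ?thesis by (simp add: J_def k_def s_def)
qed

text \<open>
  Separation of variables: along an orbit \<open>d\<tau> = - slowness \<phi> d\<psi>\<close>, and \<open>\<phi>\<close> is known as a function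
  of \<open>\<psi>\<close>. Integrating gives the time as a strictly decreasing function of \<open>\<psi>\<close>, and its inverse is
  the solution. The slowness is bounded up to \<open>\<phi> = 0\<close>, which makes the total time finite.
\<close>
lemma traverses_exists:
  assumes h: "h \<in> {0<..<2}"
  shows "\<exists>a b \<phi> \<psi>. traverses h a b \<phi> \<psi>"
proof -
  define s where "s = sqrt (2 - h)"
  have s: "s > 0" "s\<^sup>2 = 2 - h" using h by (auto simp: s_def)
  define m where "m = (\<lambda>u. slowness (profile h u))"
  have m: "continuous_on {-1..1} m"
    unfolding m_def by (rule continuous_on_comp_profile[OF continuous_on_slowness h])
  have m_pos: "m u > 0" if "u \<in> {-1..1}" for u
    using profile_in[OF h that] slowness_pos by (auto simp: m_def)
  \<comment> \<open>The time at which the orbit reaches \<open>\<psi> = s * u\<close>; the orbit ends at time \<open>0\<close>.\<close>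
  define N where "N = (\<lambda>u. - (s * integral {-1..u} m))"
  have N: "continuous_on {-1..1} N"
    unfolding N_def
    by (intro continuous_intros indefinite_integral_continuous_1 integrable_continuous_real m)
  have N_deriv: "(N has_real_derivative - (s * m u)) (at u)" if "u \<in> {-1<..<1}" for u
    unfolding N_def by (intro DERIV_minus DERIV_cmult integral_deriv_at[OF m that])
  have N_less: "N y < N x" if "-1 \<le> x" "x < y" "y \<le> 1" for x y
  proof (rule DERIV_neg_imp_decreasing_open[of x y N])
    show "\<exists>d. (N has_real_derivative d) (at t) \<and> d < 0" if "x < t" "t < y" for t
      using that \<open>-1 \<le> x\<close> \<open>y \<le> 1\<close> N_deriv[of t] m_pos[of t] s
      by (intro exI[of _ "- (s * m t)"]) auto
    show "continuous_on {x..y} N"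
      using that by (intro continuous_on_subset[OF N]) auto
  qed (use that in auto)
  have inj: "inj_on N {-1..1}"
    by (rule inj_onI) (metis N_less atLeastAtMost_iff less_irrefl linorder_neqE)
  define a where "a = N 1"
  have N_start: "N (-1) = 0" by (simp add: N_def)
  have a: "a < 0" using N_less[of "-1" 1] N_start by (simp add: a_def)
  define U where "U = the_inv_into {-1..1} N"
  have UN: "U (N u) = u" if "u \<in> {-1..1}" for u
    unfolding U_def using inj that by (rule the_inv_into_f_f)
  have img: "N ` {-1..1} = {a..0}"
  proof
    show "N ` {-1..1} \<subseteq> {a..0}"
      using N_less[of "-1"] N_less[of _ 1] N_start unfolding a_def
      by (force simp: order_le_less)
    show "{a..0} \<subseteq> N ` {-1..1}"
    proof
      fix t assume "t \<in> {a..0}"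
      then have "\<exists>u. -1 \<le> u \<and> u \<le> 1 \<and> N u = t"
        using N_start by (intro IVT2' N) (auto simp: a_def)
      then show "t \<in> N ` {-1..1}" by auto
    qed
  qed
  have U_cont: "continuous_on {a..0} U"
    using continuous_on_inv[OF N, of U] UN img by auto
  have U_ends: "U a = 1" "U 0 = -1" using UN[of 1] UN[of "-1"] N_start by (auto simp: a_def)
  have NU: "N (U t) = t" "U t \<in> {-1..1}" if "t \<in> {a..0}" for t
    using that UN img by (metis imageE)+
  have U_in: "U t \<in> {-1<..<1}" if "t \<in> {a<..<0}" for t
  proof -
    have "U t \<noteq> 1" "U t \<noteq> -1" using NU(1)[of t] that N_start by (auto simp: a_def)
    then show ?thesis using NU(2)[of t] that by auto
  qed
  have U_deriv: "(U has_real_derivative - (1 / (s * m (U t)))) (at t)" if "t \<in> {a<..<0}" for t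
  proof -
    have "(U has_real_derivative inverse (- (s * m (U t)))) (at t)"
    proof (rule DERIV_inverse_function)
      show "(N has_real_derivative - (s * m (U t))) (at (U t))"
        by (rule N_deriv[OF U_in[OF that]])
      show "- (s * m (U t)) \<noteq> 0" using s m_pos[of "U t"] U_in[OF that] by auto
      show "a < t" "t < 0" using that by auto
      show "N (U y) = y" if "a < y" "y < 0" for y using NU(1)[of y] that by simp
      have "continuous_on {a<..<0} U" by (rule continuous_on_subset[OF U_cont]) auto
      then show "isCont U t" using that by (simp add: continuous_on_eq_continuous_at)
    qed
    then show ?thesis by (simp add: inverse_eq_divide)
  qed
  define \<psi> where "\<psi> = (\<lambda>t. s * U t)"
  define \<phi> where "\<phi> = (\<lambda>t. profile h (U t))"
  have phi_in: "\<phi> t \<in> {0<..<1}" if "t \<in> {a<..<0}" for t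
    unfolding \<phi>_def profile_def
    by (intro potential_inv_in_open level_in_open h U_in that)
  have psi_deriv: "(\<psi> has_real_derivative - (1 / slowness (\<phi> t))) (at t)"
    if "t \<in> {a<..<0}" for t
  proof -
    have "(\<psi> has_real_derivative s * - (1 / (s * m (U t)))) (at t)"
      unfolding \<psi>_def by (intro DERIV_cmult U_deriv that)
    then show ?thesis using s by (simp add: m_def \<phi>_def)
  qed
  have phi_deriv: "(\<phi> has_real_derivative 2 * \<psi> t) (at t)" if "t \<in> {a<..<0}" for t
  proof -
    have "(potential_inv has_real_derivative - slowness (\<phi> t)) (at (h + (2 - h) * (U t)\<^sup>2))"
      using potential_inv_deriv[OF level_in_open[OF h U_in[OF that]]]
      by (simp add: \<phi>_def profile_def)
    moreover have "((\<lambda>t. h + (2 - h) * (U t)\<^sup>2) has_real_derivative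
        (2 - h) * (2 * U t * - (1 / (s * m (U t))))) (at t)"
      by (auto intro!: derivative_eq_intros U_deriv that)
    ultimately have "(\<phi> has_real_derivative
        - slowness (\<phi> t) * ((2 - h) * (2 * U t * - (1 / (s * m (U t)))))) (at t)"
      unfolding \<phi>_def profile_def by (rule DERIV_chain2)
    moreover have "- slowness (\<phi> t) * ((2 - h) * (2 * U t * - (1 / (s * m (U t))))) = 2 * \<psi> t"
      using s slowness_pos[of "\<phi> t"] phi_in[OF that]
      by (simp add: \<psi>_def m_def \<phi>_def power2_eq_square flip: s(2))
    ultimately show ?thesis by simp
  qed
  have onto: "(\<lambda>t. (\<phi> t, \<psi> t)) ` {a<..<0} = Gamma_curve h"
  proof
    show "(\<lambda>t. (\<phi> t, \<psi> t)) ` {a<..<0} \<subseteq> Gamma_curve h"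
      using s U_in by (auto simp: Gamma_curve_iff[OF h] \<phi>_def \<psi>_def simp flip: s_def)
    show "Gamma_curve h \<subseteq> (\<lambda>t. (\<phi> t, \<psi> t)) ` {a<..<0}"
    proof
      fix z assume "z \<in> Gamma_curve h"
      then obtain p q where z: "z = (p, q)" and u: "q / s \<in> {-1<..<1}"
        and p: "p = profile h (q / s)"
        using Gamma_curve_iff[OF h] by (cases z) (auto simp: s_def)
      have "N (q / s) \<in> {a<..<0}"
        using N_less[of "-1" "q / s"] N_less[of "q / s" 1] u N_start by (auto simp: a_def)
      moreover have "U (N (q / s)) = q / s" using u by (intro UN) auto
      ultimately show "z \<in> (\<lambda>t. (\<phi> t, \<psi> t)) ` {a<..<0}"
        using s p z by (intro image_eqI[of _ _ "N (q / s)"]) (auto simp: \<phi>_def \<psi>_def)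
    qed
  qed
  have "continuous_on {a..0} \<psi>" unfolding \<psi>_def by (intro continuous_intros U_cont)
  then have psi_lim: "(\<psi> \<longlongrightarrow> \<psi> a) (at_right a)" "(\<psi> \<longlongrightarrow> \<psi> 0) (at_left 0)"
    using a by (auto intro: continuous_on_Icc_at_rightD continuous_on_Icc_at_leftD)
  have "continuous_on {-1..1} (\<lambda>u. profile h u)"
    by (rule continuous_on_comp_profile[OF continuous_on_id h])
  then have "continuous_on {a..0} \<phi>"
    unfolding \<phi>_def using NU by (intro continuous_on_compose2[OF _ U_cont]) auto
  then have phi_lim: "(\<phi> \<longlongrightarrow> \<phi> a) (at_right a)" "(\<phi> \<longlongrightarrow> \<phi> 0) (at_left 0)"
    using a by (auto intro: continuous_on_Icc_at_rightD continuous_on_Icc_at_leftD)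
  have ends: "\<phi> a = 0" "\<phi> 0 = 0" "\<psi> a = s" "\<psi> 0 = - s"
    by (simp_all add: \<phi>_def \<psi>_def profile_def U_ends)
  have psi_ode: "(\<psi> has_real_derivative
        - (\<phi> t * f_aux (\<phi> t) / ((1 - \<phi> t) * (- \<phi> t - ln (1 - \<phi> t))\<^sup>2))) (at t)"
    if "t \<in> {a<..<0}" for t
    using psi_deriv[OF that] unfolding field_rhs_eq[OF phi_in[OF that]] .
  have "traverses h a 0 \<phi> \<psi>"
    unfolding traverses_def s_def[symmetric]
    by (intro conjI ballI a phi_deriv psi_ode onto phi_lim[unfolded ends] psi_lim[unfolded ends])
  then show ?thesis by (intro exI)
qed

lemma Qbar_eq:
  assumes "h \<in> {0<..<2}"
  shows "Qbar h = 2 * (sqrt (2 - h) * integral {-1..1} (\<lambda>u. arc_density (profile h u)))"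
  unfolding Qbar_def
proof (rule the_equality)
  show "\<exists>a b \<phi> \<psi>. traverses h a b \<phi> \<psi> \<and>
      2 * (sqrt (2 - h) * integral {-1..1} (\<lambda>u. arc_density (profile h u))) =
      2 * integral {a<..<b} (\<lambda>\<tau>. sqrt (- \<phi> \<tau> - ln (1 - \<phi> \<tau>)) / (1 - \<phi> \<tau>))"
  proof -
    obtain a b \<phi> \<psi> where "traverses h a b \<phi> \<psi>" using traverses_exists[OF assms] by (elim exE)
    then show ?thesis
      by (intro exI[of _ a] exI[of _ b] exI[of _ \<phi>] exI[of _ \<psi>] conjI)
         (simp_all only: orbit_integral[OF assms])
  qed
next
  fix q
  assume "\<exists>a b \<phi> \<psi>. traverses h a b \<phi> \<psi> \<and>
      q = 2 * integral {a<..<b} (\<lambda>\<tau>. sqrt (- \<phi> \<tau> - ln (1 - \<phi> \<tau>)) / (1 - \<phi> \<tau>))"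
  then show "q = 2 * (sqrt (2 - h) * integral {-1..1} (\<lambda>u. arc_density (profile h u)))"
    by (elim exE conjE) (simp only: orbit_integral[OF assms])
qed

section \<open>Differentiation with respect to the level\<close>

text \<open>
  For \<open>u = \<plusminus>1\<close> the profile is the end point \<open>0\<close> of the arc for every \<open>h\<close>, where the weighted slope
  vanishes too; so the formula of the chain rule persists at the boundary.
\<close>
lemma arc_density_profile_deriv:
  assumes h: "h \<in> {0<..<2}" and u: "u \<in> {-1..1}"
  shows "((\<lambda>h. arc_density (profile h u)) has_real_derivative
      - (weighted_slope (profile h u) / (2 - h))) (at h)"
proof (cases "u \<in> {-1<..<1}")
  case True
  let ?w = "h + (2 - h) * u\<^sup>2"
  have w: "?w \<in> {0<..<2}" by (rule level_in_open[OF h True])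
  have p: "profile h u \<in> {0<..<1}" unfolding profile_def by (rule potential_inv_in_open[OF w])
  have "((\<lambda>h. h + (2 - h) * u\<^sup>2) has_real_derivative 1 - u\<^sup>2) (at h)"
    by (auto intro!: derivative_eq_intros)
  from DERIV_chain2[OF potential_inv_deriv[OF w] this]
  have "((\<lambda>h. profile h u) has_real_derivative - slowness (profile h u) * (1 - u\<^sup>2)) (at h)"
    by (simp add: profile_def)
  moreover have "(arc_density has_real_derivative arc_density_deriv (profile h u)) (at (profile h u))"
    using p by (intro arc_density_has_deriv) auto
  ultimately have "((\<lambda>h. arc_density (profile h u)) has_real_derivative
      arc_density_deriv (profile h u) * (- slowness (profile h u) * (1 - u\<^sup>2))) (at h)"
    by (rule DERIV_chain2[rotated])
  moreover have "potential (profile h u) = ?w"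
    unfolding profile_def using w by (intro potential_potential_inv) auto
  then have "2 - potential (profile h u) = (2 - h) * (1 - u\<^sup>2)"
    by (simp add: algebra_simps)
  then have "arc_density_deriv (profile h u) * (- slowness (profile h u) * (1 - u\<^sup>2))
      = - (weighted_slope (profile h u) / (2 - h))"
    using h by (simp add: weighted_slope_def)
  ultimately show ?thesis by simp
next
  case False
  then have "u\<^sup>2 = 1" using u by (auto simp: not_less power2_eq_1_iff)
  then have "profile h' u = 0" for h' by (simp add: profile_def)
  then show ?thesis by simp
qed

theorem lemma5p3:
  fixes h :: real
  assumes "0 < h" and "h < 2"
  shows "\<exists>D. (Qbar has_real_derivative D) (at h) \<and> D < 0"
proof -
  define R where "R = (\<lambda>h. integral {-1..1} (\<lambda>u. arc_density (profile h u)))"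
  define R' where "R' = integral {-1..1} (\<lambda>u. - (weighted_slope (profile h u) / (2 - h)))"
  define s where "s = sqrt (2 - h)"
  have h: "h \<in> {0<..<2}" and s: "s > 0" using assms by (auto simp: s_def)
  have "((\<lambda>h. integral (cbox (-1) 1) (\<lambda>u. arc_density (profile h u))) has_real_derivative
      integral (cbox (-1) 1) (\<lambda>u. - (weighted_slope (profile h u) / (2 - h))))
      (at h within {0<..<2})"
  proof (rule leibniz_rule_field_derivative)
    show "((\<lambda>h. arc_density (profile h u)) has_real_derivative
        - (weighted_slope (profile h' u) / (2 - h'))) (at h' within {0<..<2})"
      if "h' \<in> {0<..<2}" "u \<in> cbox (-1) 1" for h' u
      using that by (intro has_field_derivative_at_within[OF arc_density_profile_deriv]) auto
    show "(\<lambda>u. arc_density (profile h' u)) integrable_on cbox (-1) 1" if "h' \<in> {0<..<2}" for h'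
      using continuous_on_comp_profile[OF continuous_on_density that]
      by (simp add: integrable_continuous_real)
    have "continuous_on ({0<..<2} \<times> {-1..1})
        (\<lambda>x. weighted_slope ((\<lambda>(h, u). profile h u) x))"
      using profile_in
      by (intro continuous_on_compose2[OF continuous_on_weighted_slope continuous_on_profile]) auto
    then show "continuous_on ({0<..<2} \<times> cbox (-1) 1)
        (\<lambda>(h, u). - (weighted_slope (profile h u) / (2 - h)))"
      unfolding case_prod_unfold by (intro continuous_intros) auto
  qed (use h in auto)
  moreover have "at h within {0<..<2} = at h" using h by (intro at_within_open) auto
  ultimately have R_deriv: "(R has_real_derivative R') (at h)"
    unfolding R_def R'_def box_real by (simp only:)
  have "0 \<le> integral {-1..1} (\<lambda>u. weighted_slope (profile h u) / (2 - h))"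
    using assms profile_in[OF h]
    by (intro integral_nonneg integrable_continuous_real continuous_intros divide_nonneg_pos
          continuous_on_comp_profile[OF continuous_on_weighted_slope h] weighted_slope_nonneg) auto
  then have "R' \<le> 0" by (simp add: R'_def)
  have "integral {-1..1} (\<lambda>u::real. 0) < R h"
    unfolding R_def
  proof (rule integral_less_real)
    show "0 < arc_density (profile h u)" if "u \<in> {-1<..<1}" for u
      using potential_inv_in_open[OF level_in_open[OF h that]]
      by (auto simp: profile_def intro: arc_density_pos)
  qed (use continuous_on_comp_profile[OF continuous_on_density h] in auto)
  then have "R h > 0" by simp
  have "((\<lambda>h. 2 * (sqrt (2 - h) * R h)) has_real_derivative
      2 * (- (1 / (2 * s)) * R h + s * R')) (at h)"
    using assms by (auto intro!: derivative_eq_intros R_deriv simp: s_def field_simps)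
  then have "(Qbar has_real_derivative 2 * (- (1 / (2 * s)) * R h + s * R')) (at h)"
    by (rule has_field_derivative_transform_within_open[of _ _ _ "{0<..<2}"])
       (use h Qbar_eq in \<open>auto simp: R_def\<close>)
  moreover have "1 / (2 * s) * R h > 0" "s * R' \<le> 0"
    using s \<open>R h > 0\<close> \<open>R' \<le> 0\<close> by (auto simp: mult_le_0_iff)
  then have "2 * (- (1 / (2 * s)) * R h + s * R') < 0" by simp
  ultimately show ?thesis by blast
qed

end
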